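(* Let $(L,\cdot)$ be a quasigroup (respectively, a loop) with holomorph $H(L)$. If $H(L)$ is a CIPQ (respectively, a CIPL), then $L$ is a flexible unipotent CIPQ (respectively, a flexible CIPL of exponent $2$).
   Context: Mappings are written on the right of their arguments and composed from left to right. A quasigroup $(L,\cdot)$ is a non-empty set with a binary operation such that for all $a,b\in L$ the equations $a\cdot x=b$ and $y\cdot a=b$ have unique solutions $x,y\in L$; a loop is a quasigroup with a two-sided identity element $e$. For $x\in L$, the right inverse $x^\rho$ and left inverse $x^\lambda$ are the elements with $x x^\rho=e^\rho$ and $x^\lambda x=e^\lambda$, where $e^\rho$ and $e^\lambda$ denote a right identity element and a left identity element of $L$ (assumed to exist whenever $x^\rho$, respectively $x^\lambda$, is used; both equal $e$ in a loop). $AUM(L)$ is the automorphism group of $(L,\cdot)$. The holomorph $H(L)=(H,\circ)$ is the set $H$ of pairs $(\alpha,x)$, $\alpha\in AUM(L)$, $x\in L$, with operation $(\alpha,x)\circ(\beta,y)=(\alpha\beta,\,x\beta\cdot y)$. A quasigroup (loop) is a cross inverse property quasigroup, CIPQ (loop, CIPL), if and only if it obeys one of the (equivalent) identities $xy\cdot x^\rho=y$, or $x\cdot yx^\rho=y$, or $x^\lambda\cdot(yx)=y$, or $x^\lambda y\cdot x=y$. Here juxtaposition binds more tightly than $\cdot$. Flexible means $xy\cdot x=x\cdot yx$ for all $x,y$; unipotent means $x\cdot x=y\cdot y$ for all $x,y$; a loop has exponent $2$ if $x\cdot x=e$ for all $x$. *)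

theory Defs
  imports Main "HOL-Library.FuncSet"
begin

text \<open>
  An algebra is given by a carrier set \<open>L\<close> together with a binary operation \<open>m\<close>, of which
  only the values on \<open>L\<close> matter.  Carriers are explicit because the holomorph lives on a
  proper subset of the type \<open>('a \<Rightarrow> 'a) \<times> 'a\<close>.
\<close>

definition quasigroup :: "'a set \<Rightarrow> ('a \<Rightarrow> 'a \<Rightarrow> 'a) \<Rightarrow> bool" where
  "quasigroup L m \<longleftrightarrow>
     L \<noteq> {} \<and>
     (\<forall>a\<in>L. \<forall>b\<in>L. m a b \<in> L) \<and>
     (\<forall>a\<in>L. \<forall>b\<in>L. (\<exists>!x. x \<in> L \<and> m a x = b) \<and> (\<exists>!y. y \<in> L \<and> m y a = b))"

definition right_identity :: "'a set \<Rightarrow> ('a \<Rightarrow> 'a \<Rightarrow> 'a) \<Rightarrow> 'a \<Rightarrow> bool" where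
  "right_identity L m e \<longleftrightarrow> e \<in> L \<and> (\<forall>x\<in>L. m x e = x)"

definition left_identity :: "'a set \<Rightarrow> ('a \<Rightarrow> 'a \<Rightarrow> 'a) \<Rightarrow> 'a \<Rightarrow> bool" where
  "left_identity L m e \<longleftrightarrow> e \<in> L \<and> (\<forall>x\<in>L. m e x = x)"

definition two_sided_identity :: "'a set \<Rightarrow> ('a \<Rightarrow> 'a \<Rightarrow> 'a) \<Rightarrow> 'a \<Rightarrow> bool" where
  "two_sided_identity L m e \<longleftrightarrow> left_identity L m e \<and> right_identity L m e"

definition loop :: "'a set \<Rightarrow> ('a \<Rightarrow> 'a \<Rightarrow> 'a) \<Rightarrow> bool" where
  "loop L m \<longleftrightarrow> quasigroup L m \<and> (\<exists>e. two_sided_identity L m e)"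

text \<open>
  The inverses are taken relative to a one-sided identity \<open>e\<close>; in a quasigroup the elements
  described are unique.
\<close>

definition right_inverse :: "'a set \<Rightarrow> ('a \<Rightarrow> 'a \<Rightarrow> 'a) \<Rightarrow> 'a \<Rightarrow> 'a \<Rightarrow> 'a" where
  "right_inverse L m e x = (THE z. z \<in> L \<and> m x z = e)"

definition left_inverse :: "'a set \<Rightarrow> ('a \<Rightarrow> 'a \<Rightarrow> 'a) \<Rightarrow> 'a \<Rightarrow> 'a \<Rightarrow> 'a" where
  "left_inverse L m e x = (THE z. z \<in> L \<and> m z x = e)"

text \<open>
  The cross inverse property: one of the four identities
  \<open>xy \<cdot> x\<^sup>\<rho> = y\<close>, \<open>x \<cdot> yx\<^sup>\<rho> = y\<close>, \<open>x\<^sup>\<lambda> \<cdot> yx = y\<close>, \<open>x\<^sup>\<lambda>y \<cdot> x = y\<close> holds, the one-sided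
  identity element that it refers to being part of the requirement.
\<close>

definition cross_inverse_property :: "'a set \<Rightarrow> ('a \<Rightarrow> 'a \<Rightarrow> 'a) \<Rightarrow> bool" where
  "cross_inverse_property L m \<longleftrightarrow>
     (\<exists>e. right_identity L m e \<and>
        (\<forall>x\<in>L. \<forall>y\<in>L. m (m x y) (right_inverse L m e x) = y)) \<or>
     (\<exists>e. right_identity L m e \<and>
        (\<forall>x\<in>L. \<forall>y\<in>L. m x (m y (right_inverse L m e x)) = y)) \<or>
     (\<exists>e. left_identity L m e \<and>
        (\<forall>x\<in>L. \<forall>y\<in>L. m (left_inverse L m e x) (m y x) = y)) \<or>
     (\<exists>e. left_identity L m e \<and>
        (\<forall>x\<in>L. \<forall>y\<in>L. m (m (left_inverse L m e x) y) x = y))"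

definition CIPQ :: "'a set \<Rightarrow> ('a \<Rightarrow> 'a \<Rightarrow> 'a) \<Rightarrow> bool" where
  "CIPQ L m \<longleftrightarrow> quasigroup L m \<and> cross_inverse_property L m"

definition CIPL :: "'a set \<Rightarrow> ('a \<Rightarrow> 'a \<Rightarrow> 'a) \<Rightarrow> bool" where
  "CIPL L m \<longleftrightarrow> loop L m \<and> cross_inverse_property L m"

definition flexible :: "'a set \<Rightarrow> ('a \<Rightarrow> 'a \<Rightarrow> 'a) \<Rightarrow> bool" where
  "flexible L m \<longleftrightarrow> (\<forall>x\<in>L. \<forall>y\<in>L. m (m x y) x = m x (m y x))"

definition unipotent :: "'a set \<Rightarrow> ('a \<Rightarrow> 'a \<Rightarrow> 'a) \<Rightarrow> bool" where
  "unipotent L m \<longleftrightarrow> (\<forall>x\<in>L. \<forall>y\<in>L. m x x = m y y)"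

definition exponent_two :: "'a set \<Rightarrow> ('a \<Rightarrow> 'a \<Rightarrow> 'a) \<Rightarrow> bool" where
  "exponent_two L m \<longleftrightarrow> (\<exists>e. two_sided_identity L m e \<and> (\<forall>x\<in>L. m x x = e))"

text \<open>
  Automorphisms are required to be \<open>extensional\<close>, so that each automorphism of the carrier is
  represented by exactly one HOL function.
\<close>

definition AUM :: "'a set \<Rightarrow> ('a \<Rightarrow> 'a \<Rightarrow> 'a) \<Rightarrow> ('a \<Rightarrow> 'a) set" where
  "AUM L m = {\<alpha> \<in> extensional L. bij_betw \<alpha> L L \<and>
                (\<forall>x\<in>L. \<forall>y\<in>L. \<alpha> (m x y) = m (\<alpha> x) (\<alpha> y))}"

definition holomorph :: "'a set \<Rightarrow> ('a \<Rightarrow> 'a \<Rightarrow> 'a) \<Rightarrow> (('a \<Rightarrow> 'a) \<times> 'a) set" where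
  "holomorph L m = AUM L m \<times> L"

text \<open>
  \<open>(\<alpha>, x) \<circ> (\<beta>, y) = (\<alpha>\<beta>, x\<beta> \<cdot> y)\<close> with mappings written on the right and composed from left
  to right: \<open>x\<beta>\<close> is \<open>\<beta> x\<close>, and \<open>\<alpha>\<beta>\<close>, first \<open>\<alpha>\<close> and then \<open>\<beta>\<close>, is \<open>compose L \<beta> \<alpha>\<close>.
\<close>

definition holomorph_mult ::
    "'a set \<Rightarrow> ('a \<Rightarrow> 'a \<Rightarrow> 'a) \<Rightarrow> ('a \<Rightarrow> 'a) \<times> 'a \<Rightarrow> ('a \<Rightarrow> 'a) \<times> 'a \<Rightarrow> ('a \<Rightarrow> 'a) \<times> 'a" where
  "holomorph_mult L m = (\<lambda>(\<alpha>, x) (\<beta>, y). (compose L \<beta> \<alpha>, m (\<beta> x) y))"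

end

theory Submission
  imports Defs
begin

text \<open>
  In a quasigroup with the cross inverse property the one-sided identity is two-sided, and all four
  identities say that \<open>xy \<cdot> z = y\<close> whenever \<open>xz = e\<close>.  Two facts then carry the proof.

  First, the holomorph has this property only if every automorphism of \<open>L\<close> is trivial: with
  \<open>xz = e\<close>, the elements \<open>(1, x)\<close>, \<open>(\<beta>, y)\<close> and \<open>(1, z)\<close> of the holomorph give
  \<open>(x\<beta> \<cdot> y) \<cdot> z = y\<close>, while \<open>\<beta> = 1\<close> gives \<open>xy \<cdot> z = y\<close>, so that \<open>x\<beta> = x\<close> by cancellation.
  The case \<open>\<beta> = 1\<close> is also the cross inverse property of \<open>L\<close>.

  Secondly, in \<open>L\<close> itself the map \<open>x \<mapsto> x\<^sup>\<rho>\<close> is an automorphism.  Hence it is trivial, that is,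
  \<open>xx = e\<close> for all \<open>x\<close>, and the cross inverse property reads \<open>xy \<cdot> x = y\<close>.  This law implies
  \<open>x \<cdot> yx = y\<close>, and the two together give flexibility.
\<close>

section \<open>Quasigroups\<close>

lemma quasigroup_closed:
  assumes "quasigroup L m" "a \<in> L" "b \<in> L"
  shows "m a b \<in> L"
  using assms unfolding quasigroup_def by blast

lemma quasigroup_left_cancel:
  assumes "quasigroup L m" "a \<in> L" "x \<in> L" "x' \<in> L" "m a x = m a x'"
  shows "x = x'"
  using assms quasigroup_closed[OF assms(1,2,3)] unfolding quasigroup_def by metis

lemma quasigroup_right_cancel:
  assumes "quasigroup L m" "a \<in> L" "y \<in> L" "y' \<in> L" "m y a = m y' a"
  shows "y = y'"
  using assms quasigroup_closed[OF assms(1,3,2)] unfolding quasigroup_def by metis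

lemma quasigroup_left_divides:
  assumes "quasigroup L m" "a \<in> L" "b \<in> L"
  obtains x where "x \<in> L" "m a x = b"
  using assms unfolding quasigroup_def by blast

lemma quasigroup_right_divides:
  assumes "quasigroup L m" "a \<in> L" "b \<in> L"
  obtains y where "y \<in> L" "m y a = b"
  using assms unfolding quasigroup_def by blast

lemma right_inverse_eqI:
  assumes "quasigroup L m" "x \<in> L" "z \<in> L" "m x z = e"
  shows "right_inverse L m e x = z"
  unfolding right_inverse_def
  using assms quasigroup_left_cancel[OF assms(1,2)] by (intro the_equality) auto

lemma left_inverse_eqI:
  assumes "quasigroup L m" "x \<in> L" "z \<in> L" "m z x = e"
  shows "left_inverse L m e x = z"
  unfolding left_inverse_def
  using assms quasigroup_right_cancel[OF assms(1,2)] by (intro the_equality) auto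

lemma right_inverse:
  assumes "quasigroup L m" "e \<in> L" "x \<in> L"
  shows "right_inverse L m e x \<in> L" "m x (right_inverse L m e x) = e"
  using right_inverse_eqI[OF assms(1,3)] quasigroup_left_divides[OF assms(1,3,2)] by metis+

section \<open>The cross inverse property\<close>

text \<open>
  The four cross inverse identities in one form that does not mention an inverse operation: the
  pairs \<open>(x, z)\<close> with \<open>xz = e\<close> are both the pairs \<open>(x, x\<^sup>\<rho>)\<close> and the pairs \<open>(z\<^sup>\<lambda>, z)\<close>.
\<close>

definition cross_inverse_at :: "'a set \<Rightarrow> ('a \<Rightarrow> 'a \<Rightarrow> 'a) \<Rightarrow> 'a \<Rightarrow> bool" where
  "cross_inverse_at L m e \<longleftrightarrow>
     two_sided_identity L m e \<and>
     (\<forall>x\<in>L. \<forall>y\<in>L. \<forall>z\<in>L. m x z = e \<longrightarrow> m (m x y) z = y)"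

text \<open>
  Both cross inverse laws say that two maps undo each other: \<open>y \<mapsto> xy\<close> and \<open>u \<mapsto> uz\<close>.  As these
  maps are bijective, it does not matter which of the two composites is the identity.
\<close>

lemma cross_inverse_law_swap:
  assumes Q: "quasigroup L m" and xz: "x \<in> L" "z \<in> L"
    and law: "\<And>y. y \<in> L \<Longrightarrow> m x (m y z) = y" and y: "y \<in> L"
  shows "m (m x y) z = y"
proof -
  obtain u where "u \<in> L" "m u z = y"
    using quasigroup_right_divides[OF Q xz(2) y] .
  with law show ?thesis by metis
qed

text \<open>
  A one-sided identity \<open>e\<close> satisfies \<open>ee = e\<close>, so \<open>x = z = e\<close> in the law gives \<open>ey \<cdot> e = y\<close>; one of
  the two factors \<open>e\<close> can be dropped, and what remains says that \<open>e\<close> is an identity on the other side.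
\<close>

lemma cross_inverse_atI:
  assumes e: "right_identity L m e \<or> left_identity L m e"
    and Q: "quasigroup L m"
    and law: "\<And>x y z. x \<in> L \<Longrightarrow> y \<in> L \<Longrightarrow> z \<in> L \<Longrightarrow> m x z = e \<Longrightarrow> m (m x y) z = y"
  shows "cross_inverse_at L m e"
proof -
  have eL: "e \<in> L" and ee: "m e e = e"
    using e unfolding right_identity_def left_identity_def by auto
  have "m (m e y) e = y" if "y \<in> L" for y
    using law[OF eL that eL ee] .
  then have "two_sided_identity L m e"
    using e quasigroup_closed[OF Q] eL
    unfolding two_sided_identity_def right_identity_def left_identity_def by metis
  then show ?thesis
    using law unfolding cross_inverse_at_def by blast
qed

lemma cross_inverse_property_iff:
  assumes Q: "quasigroup L m"
  shows "cross_inverse_property L m \<longleftrightarrow> (\<exists>e. cross_inverse_at L m e)"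
proof
  assume "cross_inverse_property L m"
  then consider
      (1) e where "right_identity L m e"
        "\<And>x y. x \<in> L \<Longrightarrow> y \<in> L \<Longrightarrow> m (m x y) (right_inverse L m e x) = y"
    | (2) e where "right_identity L m e"
        "\<And>x y. x \<in> L \<Longrightarrow> y \<in> L \<Longrightarrow> m x (m y (right_inverse L m e x)) = y"
    | (3) e where "left_identity L m e"
        "\<And>x y. x \<in> L \<Longrightarrow> y \<in> L \<Longrightarrow> m (left_inverse L m e x) (m y x) = y"
    | (4) e where "left_identity L m e"
        "\<And>x y. x \<in> L \<Longrightarrow> y \<in> L \<Longrightarrow> m (m (left_inverse L m e x) y) x = y"
    unfolding cross_inverse_property_def by blast
  then show "\<exists>e. cross_inverse_at L m e"
  proof cases
    case 1
    have "m (m x y) z = y" if "x \<in> L" "y \<in> L" "z \<in> L" "m x z = e" for x y z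
      using 1(2) right_inverse_eqI[OF Q] that by metis
    then show ?thesis using cross_inverse_atI[OF _ Q] 1(1) by blast
  next
    case 2
    have "m (m x y) z = y" if "x \<in> L" "y \<in> L" "z \<in> L" "m x z = e" for x y z
    proof (rule cross_inverse_law_swap[OF Q that(1,3) _ that(2)])
      show "m x (m u z) = u" if "u \<in> L" for u
        using 2(2)[OF \<open>x \<in> L\<close> that] right_inverse_eqI[OF Q \<open>x \<in> L\<close> \<open>z \<in> L\<close> \<open>m x z = e\<close>] by simp
    qed
    then show ?thesis using cross_inverse_atI[OF _ Q] 2(1) by blast
  next
    case 3
    have "m (m x y) z = y" if "x \<in> L" "y \<in> L" "z \<in> L" "m x z = e" for x y z
    proof (rule cross_inverse_law_swap[OF Q that(1,3) _ that(2)])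
      show "m x (m u z) = u" if "u \<in> L" for u
        using 3(2)[OF \<open>z \<in> L\<close> that] left_inverse_eqI[OF Q \<open>z \<in> L\<close> \<open>x \<in> L\<close> \<open>m x z = e\<close>] by simp
    qed
    then show ?thesis using cross_inverse_atI[OF _ Q] 3(1) by blast
  next
    case 4
    have "m (m x y) z = y" if "x \<in> L" "y \<in> L" "z \<in> L" "m x z = e" for x y z
      using 4(2) left_inverse_eqI[OF Q] that by metis
    then show ?thesis using cross_inverse_atI[OF _ Q] 4(1) by blast
  qed
next
  assume "\<exists>e. cross_inverse_at L m e"
  then obtain e where C: "cross_inverse_at L m e" ..
  then have e: "right_identity L m e"
    unfolding cross_inverse_at_def two_sided_identity_def by blast
  then have "e \<in> L" unfolding right_identity_def by blast
  then have "m (m x y) (right_inverse L m e x) = y" if "x \<in> L" "y \<in> L" for x y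
    using C right_inverse[OF Q] that unfolding cross_inverse_at_def by blast
  with e show "cross_inverse_property L m"
    unfolding cross_inverse_property_def by blast
qed

text \<open>
  Applying \<open>xy \<cdot> x\<^sup>\<rho> = y\<close> to \<open>xy\<close> and \<open>x\<^sup>\<rho>\<close> in place of \<open>x\<close> and \<open>y\<close> gives \<open>y \<cdot> (xy)\<^sup>\<rho> = x\<^sup>\<rho>\<close>, and
  applying it to \<open>y\<close> and \<open>(xy)\<^sup>\<rho>\<close> then gives \<open>x\<^sup>\<rho> \<cdot> y\<^sup>\<rho> = (xy)\<^sup>\<rho>\<close>.
\<close>

lemma right_inverse_automorphism:
  assumes Q: "quasigroup L m" and C: "cross_inverse_at L m e"
  shows "restrict (right_inverse L m e) L \<in> AUM L m"
proof -
  let ?r = "right_inverse L m e"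
  have eL: "e \<in> L"
    using C unfolding cross_inverse_at_def two_sided_identity_def right_identity_def by blast
  note closed = quasigroup_closed[OF Q] and r = right_inverse[OF Q eL]
  have law: "m (m x y) (?r x) = y" if "x \<in> L" "y \<in> L" for x y
    using C r that unfolding cross_inverse_at_def by blast
  have hom: "?r (m x y) = m (?r x) (?r y)" if "x \<in> L" "y \<in> L" for x y
  proof -
    have "m (m (m x y) (?r x)) (?r (m x y)) = ?r x"
      using law closed r that by blast
    then have "m y (?r (m x y)) = ?r x"
      using law that by simp
    moreover have "m (m y (?r (m x y))) (?r y) = ?r (m x y)"
      using law closed r that by blast
    ultimately show ?thesis by simp
  qed
  have "inj_on ?r L"
    using quasigroup_right_cancel[OF Q] r unfolding inj_on_def by metis
  moreover have "?r ` L = L"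
  proof
    show "?r ` L \<subseteq> L" using r by blast
    show "L \<subseteq> ?r ` L"
    proof
      fix z assume "z \<in> L"
      obtain x where "x \<in> L" "m x z = e"
        using quasigroup_right_divides[OF Q \<open>z \<in> L\<close> eL] .
      then have "?r x = z"
        using right_inverse_eqI[OF Q] \<open>z \<in> L\<close> by blast
      with \<open>x \<in> L\<close> show "z \<in> ?r ` L" by blast
    qed
  qed
  ultimately show ?thesis
    using hom closed unfolding AUM_def bij_betw_def by (simp cong: inj_on_cong)
qed

section \<open>Holomorphs with the cross inverse property\<close>

lemma id_in_AUM:
  assumes "quasigroup L m"
  shows "restrict (\<lambda>x. x) L \<in> AUM L m"
  using quasigroup_closed[OF assms] unfolding AUM_def bij_betw_def inj_on_def by simp

text \<open>
  The transfer from the holomorph to \<open>L\<close>, with an arbitrary automorphism \<open>\<beta>\<close> left in the law: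
  \<open>(1, x)\<close>, \<open>(\<beta>, y)\<close> and \<open>(1, z)\<close> are multiplied, where \<open>(1, x) \<circ> (1, z) = (1, xz)\<close> is the identity.
\<close>

lemma holomorph_cross_inverse_at:
  assumes Q: "quasigroup L m"
    and C: "cross_inverse_at (holomorph L m) (holomorph_mult L m) E"
  shows "right_identity L m (snd E)"
    and "\<And>\<beta> x y z. \<lbrakk>\<beta> \<in> AUM L m; x \<in> L; y \<in> L; z \<in> L; m x z = snd E\<rbrakk> \<Longrightarrow>
      m (m (\<beta> x) y) z = y"
proof -
  let ?i = "restrict (\<lambda>x. x) L"
  have i: "?i \<in> AUM L m" using id_in_AUM[OF Q] .
  have ii: "compose L ?i ?i = ?i" by (auto simp: compose_def)
  obtain \<epsilon> e where E: "E = (\<epsilon>, e)" by force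
  have rid: "right_identity (holomorph L m) (holomorph_mult L m) E"
    using C unfolding cross_inverse_at_def two_sided_identity_def by blast
  have \<epsilon>: "\<epsilon> \<in> AUM L m" and e: "e \<in> L"
    and unit: "\<And>\<alpha> x. \<alpha> \<in> AUM L m \<Longrightarrow> x \<in> L \<Longrightarrow>
      compose L \<epsilon> \<alpha> = \<alpha> \<and> m (\<epsilon> x) e = x"
    using rid unfolding right_identity_def holomorph_def holomorph_mult_def E by auto
  have "\<epsilon> = compose L \<epsilon> ?i"
    using \<epsilon> by (auto simp: AUM_def compose_def extensional_def fun_eq_iff)
  also have "\<dots> = ?i" using unit[OF i e] by blast
  finally have \<epsilon>_id: "\<epsilon> = ?i" .
  show "right_identity L m (snd E)"
    using unit[OF i] e unfolding right_identity_def \<epsilon>_id E by simp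
  show "m (m (\<beta> x) y) z = y"
    if "\<beta> \<in> AUM L m" "x \<in> L" "y \<in> L" "z \<in> L" "m x z = snd E" for \<beta> x y z
  proof -
    let ?H = "holomorph_mult L m"
    have mem: "(?i, x) \<in> holomorph L m" "(\<beta>, y) \<in> holomorph L m" "(?i, z) \<in> holomorph L m"
      using that i unfolding holomorph_def by auto
    have "?H (?i, x) (?i, z) = E"
      using that ii unfolding holomorph_mult_def E \<epsilon>_id by simp
    then have "?H (?H (?i, x) (\<beta>, y)) (?i, z) = (\<beta>, y)"
      using C mem unfolding cross_inverse_at_def by blast
    moreover have "\<beta> x \<in> L"
      using that unfolding AUM_def by (auto dest: bij_betwE)
    ultimately show ?thesis
      using quasigroup_closed[OF Q] that unfolding holomorph_mult_def by simp
  qed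
qed

text \<open>
  Comparing the law for \<open>\<beta>\<close> with the law for the identity automorphism and cancelling yields
  \<open>x\<beta> = x\<close>; the automorphism to which this is applied is \<open>x \<mapsto> x\<^sup>\<rho>\<close>.
\<close>

lemma holomorph_cross_inverse_imp_square_eq:
  assumes Q: "quasigroup L m"
    and QH: "quasigroup (holomorph L m) (holomorph_mult L m)"
    and CH: "cross_inverse_property (holomorph L m) (holomorph_mult L m)"
  obtains e where "cross_inverse_at L m e" and "\<And>x. x \<in> L \<Longrightarrow> m x x = e"
proof -
  obtain E where CE: "cross_inverse_at (holomorph L m) (holomorph_mult L m) E"
    using CH cross_inverse_property_iff[OF QH] by blast
  define e where "e = snd E"
  note e = holomorph_cross_inverse_at(1)[OF Q CE, folded e_def]
    and law = holomorph_cross_inverse_at(2)[OF Q CE, folded e_def]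
  have eL: "e \<in> L" using e unfolding right_identity_def by blast
  note closed = quasigroup_closed[OF Q] and r = right_inverse[OF Q eL]
  have C_law: "m (m x y) z = y" if "x \<in> L" "y \<in> L" "z \<in> L" "m x z = e" for x y z
    using law[OF id_in_AUM[OF Q] that] that(1) by simp
  with e have C: "cross_inverse_at L m e"
    using cross_inverse_atI[OF _ Q] by blast
  have triv: "\<beta> x = x" if \<beta>: "\<beta> \<in> AUM L m" and x: "x \<in> L" for \<beta> x
  proof -
    have \<beta>x: "\<beta> x \<in> L" using \<beta> x unfolding AUM_def by (auto dest: bij_betwE)
    have "m (m (\<beta> x) e) (right_inverse L m e x) = m (m x e) (right_inverse L m e x)"
      using law[OF \<beta> x eL r[OF x]] C_law[OF x eL r[OF x]] by simp
    then have "m (\<beta> x) e = m x e"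
      by (rule quasigroup_right_cancel[OF Q r(1)[OF x] closed[OF \<beta>x eL] closed[OF x eL]])
    then show ?thesis
      using e x \<beta>x unfolding right_identity_def by simp
  qed
  have "m x x = e" if x: "x \<in> L" for x
    using triv[OF right_inverse_automorphism[OF Q C] x] r(2)[OF x] x by simp
  with C show thesis by (rule that)
qed

text \<open>
  When \<open>xx = e\<close>, the law is \<open>xy \<cdot> x = y\<close>.  Since \<open>x = yx \<cdot> y\<close>, also
  \<open>x \<cdot> yx = (yx \<cdot> y) \<cdot> yx = y\<close>.
\<close>

lemma cross_inverse_at_square_eq_imp_flexible:
  assumes Q: "quasigroup L m" and C: "cross_inverse_at L m e"
    and sq: "\<And>x. x \<in> L \<Longrightarrow> m x x = e"
  shows "flexible L m"
  unfolding flexible_def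
proof (intro ballI)
  fix x y assume xy: "x \<in> L" "y \<in> L"
  have law: "m (m a b) a = b" if "a \<in> L" "b \<in> L" for a b
    using C sq that unfolding cross_inverse_at_def by blast
  have "m x (m y x) = m (m (m y x) y) (m y x)"
    using law[OF xy(2,1)] by simp
  also have "\<dots> = y"
    using law quasigroup_closed[OF Q] xy by blast
  finally show "m (m x y) x = m x (m y x)"
    using law[OF xy] by simp
qed

theorem corollary2p4:
  fixes L :: "'a set" and m :: "'a \<Rightarrow> 'a \<Rightarrow> 'a"
  shows "(quasigroup L m \<and> CIPQ (holomorph L m) (holomorph_mult L m) \<longrightarrow>
            flexible L m \<and> unipotent L m \<and> CIPQ L m) \<and>
         (loop L m \<and> CIPL (holomorph L m) (holomorph_mult L m) \<longrightarrow>
            flexible L m \<and> CIPL L m \<and> exponent_two L m)"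
proof -
  have main: "flexible L m \<and> unipotent L m \<and> cross_inverse_property L m \<and> exponent_two L m"
    if Q: "quasigroup L m" and QH: "CIPQ (holomorph L m) (holomorph_mult L m)"
  proof -
    obtain e where C: "cross_inverse_at L m e" and sq: "\<And>x. x \<in> L \<Longrightarrow> m x x = e"
      using holomorph_cross_inverse_imp_square_eq[OF Q] QH unfolding CIPQ_def by blast
    have "flexible L m"
      using cross_inverse_at_square_eq_imp_flexible[OF Q C sq] .
    moreover have "unipotent L m"
      using sq unfolding unipotent_def by simp
    moreover have "cross_inverse_property L m"
      using C cross_inverse_property_iff[OF Q] by blast
    moreover have "exponent_two L m"
      using C sq unfolding cross_inverse_at_def exponent_two_def by blast
    ultimately show ?thesis by blast
  qed
  then show ?thesis
    unfolding CIPL_def CIPQ_def loop_def by blast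
qed

end
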